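(* With the notation of the context, assume $\tilde c=0$ and $\lambda=\tilde\lambda$. Then, for $i\in\{1,2\}$ and $x\in\mathbb{R}$, $$\lim_{c\to0^+}\bar x_i(c)=\lim_{c\to0^+}x_i^*(c)=\tilde s,\qquad \lim_{c\to0^+}V_1^c(x)=\frac{\tilde s-s_1}{\rho}+\lambda(x-\tilde s),\qquad \lim_{c\to0^+}V_2^c(x)=\frac{s_2-\tilde s}{\rho}-\lambda(x-\tilde s).$$
   Context: Fix $\rho,\sigma>0$, $s_1<s_2$, $\tilde c\ge0$, $\lambda\ge\tilde\lambda\ge0$ with $1-\lambda\rho>0$, and $\tilde s\in\mathbb{R}$; the parameter $c$ varies in $]\tilde c,\infty[$. Set $\theta=\sqrt{2\rho/\sigma^2}$ and $\eta=(1-\lambda\rho)/\rho>0$. For $c>0$ let $\xi(c)$ be the unique zero in $(0,\eta)$ of $F(x)=2x+\theta c-\eta\log\frac{\eta+x}{\eta-x}$, and let $$\Gamma(c)=\frac{\theta(c-\tilde c)}{4\xi(c)}+\frac{\theta c(\lambda-\tilde\lambda)}{4\eta\xi(c)}+\frac{\lambda-\tilde\lambda}{2\eta}.$$ For $i,j\in\{1,2\}$ set (writing $\xi=\xi(c)$, $\Gamma=\Gamma(c)$) $$\bar x_i(c)=\tilde s+\frac{(-1)^i}{\theta}\log\Big[\sqrt{\tfrac{\eta+\xi}{\eta-\xi}}\big(\sqrt{\Gamma+1}+\sqrt\Gamma\big)\Big],\qquad x_i^*(c)=\tilde s+\frac{(-1)^i}{\theta}\log\Big[\sqrt{\tfrac{\eta-\xi}{\eta+\xi}}\big(\sqrt{\Gamma+1}+\sqrt\Gamma\big)\Big],$$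 $$A_{ij}(c)=e^{(-1)^j\theta\tilde s}\,\frac{\sqrt{\eta^2-\xi^2}}{2\theta}\Big((-1)^{i+j+1}\sqrt{\Gamma+1}-\sqrt\Gamma\Big).$$ With $\varphi_2(x)=A_{21}(c)e^{\theta x}+A_{22}(c)e^{-\theta x}+(s_2-x)/\rho$, define (dependence of $\bar x_i,x_i^*$ on $c$ omitted) $$V_2^c(x)=\begin{cases}\varphi_2(x_1^* )+\tilde c+\tilde\lambda(x_1^*-x),&x\le\bar x_1,\\ \varphi_2(x),&\bar x_1<x<\bar x_2,\\ \varphi_2(x_2^* )-c-\lambda(x-x_2^* ),&x\ge\bar x_2,\end{cases}\qquad V_1^c(x)=V_2^c(2\tilde s-x)+\frac{2\tilde s-(s_1+s_2)}{\rho}.$$ These are the payoff functions of the two players at the Nash equilibrium of index $\tilde s$ in an impulse game on a scaled Brownian motion $\sigma W$ with running payoffs $x-s_1$ and $s_2-x$, discount rate $\rho$, intervention cost $c+\lambda|\delta|$ and gain $\tilde c+\tilde\lambda|\delta|$ for the opponent; player 1 shifts the state to $x_1^*$ when it is $\le\bar x_1$, player 2 shifts it to $x_2^*$ when it is $\ge\bar x_2$. *)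

theory Defs imports Complex_Main begin

definition theta :: "real \<Rightarrow> real \<Rightarrow> real" where
  "theta \<rho> \<sigma> = sqrt (2 * \<rho> / \<sigma>\<^sup>2)"

definition eta :: "real \<Rightarrow> real \<Rightarrow> real" where
  "eta \<rho> lam = (1 - lam * \<rho>) / \<rho>"

definition F :: "real \<Rightarrow> real \<Rightarrow> real \<Rightarrow> real \<Rightarrow> real \<Rightarrow> real" where
  "F \<rho> \<sigma> lam c x =
     2 * x + theta \<rho> \<sigma> * c - eta \<rho> lam * ln ((eta \<rho> lam + x) / (eta \<rho> lam - x))"

(* The description is proper when 0 < \<rho>, 0 < \<sigma>, 0 < 1 - lam * \<rho> and 0 < c:
   F is then strictly decreasing on [0, eta[, positive at 0, and tends to -infinity at eta. *)
definition xi :: "real \<Rightarrow> real \<Rightarrow> real \<Rightarrow> real \<Rightarrow> real" where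
  "xi \<rho> \<sigma> lam c = (THE x. x \<in> {0<..<eta \<rho> lam} \<and> F \<rho> \<sigma> lam c x = 0)"

(* Throughout, ct, lamt and st are the parameters usually written with a tilde:
   the fixed and proportional gains of the opponent, and the index of the equilibrium. *)
definition Gam :: "real \<Rightarrow> real \<Rightarrow> real \<Rightarrow> real \<Rightarrow> real \<Rightarrow> real \<Rightarrow> real" where
  "Gam \<rho> \<sigma> ct lam lamt c =
     theta \<rho> \<sigma> * (c - ct) / (4 * xi \<rho> \<sigma> lam c)
     + theta \<rho> \<sigma> * c * (lam - lamt) / (4 * eta \<rho> lam * xi \<rho> \<sigma> lam c)
     + (lam - lamt) / (2 * eta \<rho> lam)"

(* Players are the natural numbers 1 and 2; other indices have no meaning. *)
definition xbar :: "real \<Rightarrow> real \<Rightarrow> real \<Rightarrow> real \<Rightarrow> real \<Rightarrow> real \<Rightarrow> nat \<Rightarrow> real \<Rightarrow> real" where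
  "xbar \<rho> \<sigma> ct lam lamt st i c =
     (let \<xi> = xi \<rho> \<sigma> lam c; \<Gamma> = Gam \<rho> \<sigma> ct lam lamt c; \<eta> = eta \<rho> lam
      in st + (-1) ^ i / theta \<rho> \<sigma>
           * ln (sqrt ((\<eta> + \<xi>) / (\<eta> - \<xi>)) * (sqrt (\<Gamma> + 1) + sqrt \<Gamma>)))"

definition xstar :: "real \<Rightarrow> real \<Rightarrow> real \<Rightarrow> real \<Rightarrow> real \<Rightarrow> real \<Rightarrow> nat \<Rightarrow> real \<Rightarrow> real" where
  "xstar \<rho> \<sigma> ct lam lamt st i c =
     (let \<xi> = xi \<rho> \<sigma> lam c; \<Gamma> = Gam \<rho> \<sigma> ct lam lamt c; \<eta> = eta \<rho> lam
      in st + (-1) ^ i / theta \<rho> \<sigma>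
           * ln (sqrt ((\<eta> - \<xi>) / (\<eta> + \<xi>)) * (sqrt (\<Gamma> + 1) + sqrt \<Gamma>)))"

definition A :: "real \<Rightarrow> real \<Rightarrow> real \<Rightarrow> real \<Rightarrow> real \<Rightarrow> real \<Rightarrow> nat \<Rightarrow> nat \<Rightarrow> real \<Rightarrow> real" where
  "A \<rho> \<sigma> ct lam lamt st i j c =
     (let \<xi> = xi \<rho> \<sigma> lam c; \<Gamma> = Gam \<rho> \<sigma> ct lam lamt c; \<eta> = eta \<rho> lam; \<theta> = theta \<rho> \<sigma>
      in exp ((-1) ^ j * \<theta> * st) * (sqrt (\<eta>\<^sup>2 - \<xi>\<^sup>2) / (2 * \<theta>))
           * ((-1) ^ (i + j + 1) * sqrt (\<Gamma> + 1) - sqrt \<Gamma>))"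

definition phi2 ::
  "real \<Rightarrow> real \<Rightarrow> real \<Rightarrow> real \<Rightarrow> real \<Rightarrow> real \<Rightarrow> real \<Rightarrow> real \<Rightarrow> real \<Rightarrow> real" where
  "phi2 \<rho> \<sigma> s2 ct lam lamt st c x =
     A \<rho> \<sigma> ct lam lamt st 2 1 c * exp (theta \<rho> \<sigma> * x)
     + A \<rho> \<sigma> ct lam lamt st 2 2 c * exp (- theta \<rho> \<sigma> * x)
     + (s2 - x) / \<rho>"

definition V2 ::
  "real \<Rightarrow> real \<Rightarrow> real \<Rightarrow> real \<Rightarrow> real \<Rightarrow> real \<Rightarrow> real \<Rightarrow> real \<Rightarrow> real \<Rightarrow> real" where
  "V2 \<rho> \<sigma> s2 ct lam lamt st c x =
     (let x1 = xstar \<rho> \<sigma> ct lam lamt st 1 c;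
          x2 = xstar \<rho> \<sigma> ct lam lamt st 2 c;
          \<phi>2 = phi2 \<rho> \<sigma> s2 ct lam lamt st c
      in if x \<le> xbar \<rho> \<sigma> ct lam lamt st 1 c then \<phi>2 x1 + ct + lamt * (x1 - x)
         else if x < xbar \<rho> \<sigma> ct lam lamt st 2 c then \<phi>2 x
         else \<phi>2 x2 - c - lam * (x - x2))"

definition V1 ::
  "real \<Rightarrow> real \<Rightarrow> real \<Rightarrow> real \<Rightarrow> real \<Rightarrow> real \<Rightarrow> real \<Rightarrow> real \<Rightarrow> real \<Rightarrow> real \<Rightarrow> real" where
  "V1 \<rho> \<sigma> s1 s2 ct lam lamt st c x =
     V2 \<rho> \<sigma> s2 ct lam lamt st c (2 * st - x) + (2 * st - (s1 + s2)) / \<rho>"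

end

theory Submission imports Defs begin

text \<open>When the opponent has no fixed gain and the proportional cost and gain agree, \<open>Gam\<close> reduces to
  \<open>\<theta> c / (4 \<xi>)\<close>, so everything depends on how fast \<open>\<xi>\<close> vanishes with \<open>c\<close>. The equation \<open>F = 0\<close> reads
  \<open>\<theta> c = g \<xi>\<close> with \<open>g = cost_map \<eta>\<close>, an increasing bijection from \<open>]0, \<eta>[\<close>
  onto \<open>]0, \<infinity>[\<close>; hence \<open>\<xi>\<close> tends to \<open>0\<close>. Moreover \<open>g\<close> has a critical point at \<open>0\<close>, so
  \<open>\<theta> c / \<xi> = g \<xi> / \<xi>\<close> tends to \<open>g' 0 = 0\<close>: the cost is of lower order than \<open>\<xi>\<close>
  (in fact of order \<open>\<xi>\<^sup>3\<close>), and \<open>Gam\<close> tends to \<open>0\<close>.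

  The logarithms in the thresholds and targets then tend to \<open>ln 1 = 0\<close>, which sends these four points
  to \<open>st\<close>. The two exponential terms of \<open>phi2\<close> cancel at \<open>st\<close> in the limit, so \<open>phi2\<close>
  evaluated at any point moving towards \<open>st\<close> tends to \<open>(s2 - st) / \<rho>\<close>. For small \<open>c\<close>, each state \<open>x \<noteq> st\<close>
  lies in an intervention region, where the payoff is the value at the target plus a linear
  term; at \<open>x = st\<close> the limits of the three branches agree. The statement for player 1 follows by
  reflection about \<open>st\<close>.\<close>

section \<open>The scaled cost as a function of the zero of F\<close>

definition cost_map :: "real \<Rightarrow> real \<Rightarrow> real" where
  "cost_map \<eta> x = \<eta> * ln ((\<eta> + x) / (\<eta> - x)) - 2 * x"

lemma F_eq_zero_iff: "F \<rho> \<sigma> lam c x = 0 \<longleftrightarrow> cost_map (eta \<rho> lam) x = theta \<rho> \<sigma> * c"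
  by (auto simp: F_def cost_map_def)

lemma theta_pos: "\<rho> > 0 \<Longrightarrow> \<sigma> > 0 \<Longrightarrow> theta \<rho> \<sigma> > 0"
  by (simp add: theta_def)

lemma eta_pos: "\<rho> > 0 \<Longrightarrow> 1 - lam * \<rho> > 0 \<Longrightarrow> eta \<rho> lam > 0"
  by (simp add: eta_def)

lemma cost_map_zero [simp]: "cost_map \<eta> 0 = 0"
  by (cases "\<eta> = 0") (simp_all add: cost_map_def)

lemma cost_map_deriv:
  assumes "0 \<le> x" "x < \<eta>"
  shows "(cost_map \<eta> has_real_derivative 2 * x\<^sup>2 / (\<eta>\<^sup>2 - x\<^sup>2)) (at x)"
proof -
  have pos: "\<eta> + x > 0" "\<eta> - x > 0" using assms by auto
  then have sq: "\<eta>\<^sup>2 - x\<^sup>2 > 0"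
    using mult_pos_pos[OF pos] by (simp add: power2_eq_square algebra_simps)
  have "((\<lambda>x. \<eta> * ln ((\<eta> + x) / (\<eta> - x)) - 2 * x) has_real_derivative
      \<eta> * ((1 * (\<eta> - x) - (\<eta> + x) * (0 - 1)) / ((\<eta> - x) * (\<eta> - x)) / ((\<eta> + x) / (\<eta> - x))) - 2) (at x)"
    using pos by (auto intro!: derivative_eq_intros simp: mult_ac)
  also have "\<eta> * ((1 * (\<eta> - x) - (\<eta> + x) * (0 - 1)) / ((\<eta> - x) * (\<eta> - x)) / ((\<eta> + x) / (\<eta> - x))) - 2
      = 2 * x\<^sup>2 / (\<eta>\<^sup>2 - x\<^sup>2)"
    using pos sq by (simp add: divide_simps) (simp add: power2_eq_square algebra_simps)
  finally show ?thesis
    by (simp add: cost_map_def[abs_def])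
qed

lemma continuous_on_cost_map: "continuous_on {0..<\<eta>} (cost_map \<eta>)"
  by (auto intro!: continuous_at_imp_continuous_on DERIV_isCont[OF cost_map_deriv])

text \<open>The derivative vanishes at \<open>0\<close>, a possible left end point, so its sign is used only in the
  interior, with continuity at the end points.\<close>
lemma cost_map_strict_mono:
  assumes "0 \<le> a" "a < b" "b < \<eta>"
  shows "cost_map \<eta> a < cost_map \<eta> b"
proof (rule DERIV_pos_imp_increasing_open[OF assms(2)])
  fix x assume x: "a < x" "x < b"
  then have "x\<^sup>2 < \<eta>\<^sup>2" using assms by (intro power_strict_mono) auto
  then show "\<exists>y. (cost_map \<eta> has_real_derivative y) (at x) \<and> y > 0"
    using x assms by (intro exI[of _ "2 * x\<^sup>2 / (\<eta>\<^sup>2 - x\<^sup>2)"] conjI cost_map_deriv) auto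
next
  show "continuous_on {a..b} (cost_map \<eta>)"
    using assms by (auto intro: continuous_on_subset[OF continuous_on_cost_map])
qed

text \<open>Substituting \<open>x = \<eta> tanh k\<close> turns the logarithm into \<open>2 k\<close>, so the value exceeds
  \<open>2 \<eta> (k - 1)\<close> and every level is passed somewhere in \<open>]0, \<eta>[\<close>.\<close>
lemma cost_map_surj:
  assumes "\<eta> > 0" "y > 0"
  shows "\<exists>x\<in>{0<..<\<eta>}. cost_map \<eta> x = y"
proof -
  define k where "k = 1 + y / (2 * \<eta>)"
  define b where "b = \<eta> * tanh k"
  have k: "k > 0" using assms by (simp add: k_def add_pos_pos)
  have b: "0 < b" "b < \<eta>"
    using k assms tanh_real_lt_1[of k] by (auto simp: b_def)
  have "(\<eta> + b) / (\<eta> - b) = (1 + tanh k) / (1 - tanh k)"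
    using assms mult_divide_mult_cancel_left[of \<eta> "1 + tanh k" "1 - tanh k"]
    by (simp add: b_def algebra_simps)
  moreover have "ln ((1 + tanh k) / (1 - tanh k)) = 2 * k"
    using artanh_tanh_real[of k] by (simp add: artanh_def)
  ultimately have "cost_map \<eta> b = 2 * \<eta> * k - 2 * b"
    by (simp add: cost_map_def)
  also have "\<dots> \<ge> 2 * \<eta> * k - 2 * \<eta>" using b by simp
  also have "2 * \<eta> * k - 2 * \<eta> = y" using assms by (simp add: k_def field_simps)
  finally have yb: "y \<le> cost_map \<eta> b" .
  have "\<exists>x\<ge>0. x \<le> b \<and> cost_map \<eta> x = y"
    using b assms yb
    by (intro IVT') (auto intro: continuous_on_subset[OF continuous_on_cost_map])
  then obtain x where "x \<ge> 0" "x \<le> b" "cost_map \<eta> x = y" by blast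
  moreover have "x \<noteq> 0" using calculation assms by auto
  ultimately show ?thesis using b by (intro bexI[of _ x]) auto
qed

text \<open>This quotient is \<open>\<theta> c / \<xi>\<close> at \<open>x = \<xi>\<close>; its limit is the derivative at the critical point \<open>0\<close>.\<close>
lemma cost_map_quotient_tendsto:
  assumes "\<eta> > 0"
  shows "((\<lambda>x. cost_map \<eta> x / x) \<longlongrightarrow> 0) (at_right 0)"
proof -
  have "(cost_map \<eta> has_real_derivative 0) (at 0)"
    using cost_map_deriv[of 0 \<eta>] assms by simp
  then have "((\<lambda>x. cost_map \<eta> x / x) \<longlongrightarrow> 0) (at 0)"
    by (simp add: has_field_derivative_iff)
  then show ?thesis
    by (rule tendsto_within_subset) simp
qed

section \<open>Asymptotics of the zero for small costs\<close>

context
  fixes \<rho> \<sigma> lam :: real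
  assumes rho: "\<rho> > 0" and sigma: "\<sigma> > 0" and lam: "1 - lam * \<rho> > 0"
begin

lemma xi_properties:
  assumes "c > 0"
  shows "xi \<rho> \<sigma> lam c \<in> {0<..<eta \<rho> lam}"
    and "cost_map (eta \<rho> lam) (xi \<rho> \<sigma> lam c) = theta \<rho> \<sigma> * c"
proof -
  let ?P = "\<lambda>x. x \<in> {0<..<eta \<rho> lam} \<and> F \<rho> \<sigma> lam c x = 0"
  have "\<exists>x. ?P x"
    using cost_map_surj[OF eta_pos[OF rho lam], of "theta \<rho> \<sigma> * c"] theta_pos[OF rho sigma] assms
    by (auto simp: F_eq_zero_iff)
  moreover have "x = y" if "?P x" "?P y" for x y
  proof (rule ccontr)
    have eq: "cost_map (eta \<rho> lam) x = cost_map (eta \<rho> lam) y"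
      using that by (simp add: F_eq_zero_iff)
    assume "x \<noteq> y"
    then consider "x < y" | "y < x" by linarith
    then show False
      using that eq cost_map_strict_mono[of x y "eta \<rho> lam"] cost_map_strict_mono[of y x "eta \<rho> lam"]
      by cases simp_all
  qed
  ultimately have "\<exists>!x. ?P x"
    by (rule ex_ex1I)
  then have "?P (xi \<rho> \<sigma> lam c)"
    unfolding xi_def by (rule theI')
  then show "xi \<rho> \<sigma> lam c \<in> {0<..<eta \<rho> lam}"
    and "cost_map (eta \<rho> lam) (xi \<rho> \<sigma> lam c) = theta \<rho> \<sigma> * c"
    by (auto simp: F_eq_zero_iff)
qed

text \<open>Since \<open>cost_map\<close> is increasing, \<open>\<xi> < e\<close> as soon as \<open>\<theta> c\<close> is below the positive value of
  \<open>cost_map\<close> at \<open>e\<close>.\<close>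
lemma xi_at_right_0: "filterlim (xi \<rho> \<sigma> lam) (at_right 0) (at_right 0)"
proof -
  have pos: "\<forall>\<^sub>F c in at_right 0. xi \<rho> \<sigma> lam c > 0"
    using eventually_at_right_less by eventually_elim (use xi_properties(1) in auto)
  have "(xi \<rho> \<sigma> lam \<longlongrightarrow> 0) (at_right 0)"
  proof (rule order_tendstoI)
    fix a :: real assume "a < 0"
    show "\<forall>\<^sub>F c in at_right 0. a < xi \<rho> \<sigma> lam c"
      using pos by eventually_elim (use \<open>a < 0\<close> in simp)
  next
    fix a :: real assume "0 < a"
    \<comment> \<open>Monotonicity is available only below \<open>\<eta>\<close>, so \<open>a\<close> is replaced by a smaller bound.\<close>
    define e where "e = min a (eta \<rho> lam / 2)"
    have e: "0 < e" "e < eta \<rho> lam" "e \<le> a"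
      using \<open>0 < a\<close> eta_pos[OF rho lam] by (auto simp: e_def)
    have "cost_map (eta \<rho> lam) e / theta \<rho> \<sigma> > 0"
      using cost_map_strict_mono[of 0 e "eta \<rho> lam"] e theta_pos[OF rho sigma] by simp
    then have "\<forall>\<^sub>F c in at_right 0. c \<in> {0<..<cost_map (eta \<rho> lam) e / theta \<rho> \<sigma>}"
      by (rule eventually_at_right_real)
    then show "\<forall>\<^sub>F c in at_right 0. xi \<rho> \<sigma> lam c < a"
    proof eventually_elim
      case (elim c)
      then have "cost_map (eta \<rho> lam) (xi \<rho> \<sigma> lam c) < cost_map (eta \<rho> lam) e"
        using xi_properties(2)[of c] theta_pos[OF rho sigma] by (simp add: field_simps)
      then have "xi \<rho> \<sigma> lam c < e"
        using cost_map_strict_mono[of e "xi \<rho> \<sigma> lam c" "eta \<rho> lam"] xi_properties(1)[of c] e elim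
        by (cases e "xi \<rho> \<sigma> lam c" rule: linorder_cases) auto
      then show ?case using e by simp
    qed
  qed
  moreover have "\<forall>\<^sub>F c in at_right 0. xi \<rho> \<sigma> lam c \<in> {0<..} \<and> xi \<rho> \<sigma> lam c \<noteq> 0"
    using pos by eventually_elim simp
  ultimately show ?thesis
    by (simp add: filterlim_at)
qed

lemma xi_tendsto_0: "(xi \<rho> \<sigma> lam \<longlongrightarrow> 0) (at_right 0)"
  using xi_at_right_0 by (simp add: filterlim_at)

lemma Gam_tendsto_0: "(Gam \<rho> \<sigma> 0 lam lam \<longlongrightarrow> 0) (at_right 0)"
proof -
  have "((\<lambda>c. cost_map (eta \<rho> lam) (xi \<rho> \<sigma> lam c) / xi \<rho> \<sigma> lam c / 4) \<longlongrightarrow> 0 / 4) (at_right 0)"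
    by (rule tendsto_divide[OF filterlim_compose[OF cost_map_quotient_tendsto[OF eta_pos[OF rho lam]]
        xi_at_right_0] tendsto_const]) simp
  moreover have "\<forall>\<^sub>F c in at_right 0.
      cost_map (eta \<rho> lam) (xi \<rho> \<sigma> lam c) / xi \<rho> \<sigma> lam c / 4 = Gam \<rho> \<sigma> 0 lam lam c"
    using eventually_at_right_less
    by eventually_elim (simp add: Gam_def xi_properties(2))
  ultimately show ?thesis
    by (auto dest: Lim_transform_eventually)
qed

section \<open>Limits of thresholds, targets and payoffs\<close>

lemma sqrt_Gam_sum_tendsto:
  "((\<lambda>c. sqrt (Gam \<rho> \<sigma> 0 lam lam c + 1) + sqrt (Gam \<rho> \<sigma> 0 lam lam c)) \<longlongrightarrow> 1) (at_right 0)"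
  using tendsto_add[OF tendsto_real_sqrt[OF tendsto_add[OF Gam_tendsto_0 tendsto_const[of 1]]]
      tendsto_real_sqrt[OF Gam_tendsto_0]]
  by simp

lemma xbar_tendsto: "(xbar \<rho> \<sigma> 0 lam lam st i \<longlongrightarrow> st) (at_right 0)"
proof -
  have "((\<lambda>c. st + (-1) ^ i / theta \<rho> \<sigma>
      * ln (sqrt ((eta \<rho> lam + xi \<rho> \<sigma> lam c) / (eta \<rho> lam - xi \<rho> \<sigma> lam c))
        * (sqrt (Gam \<rho> \<sigma> 0 lam lam c + 1) + sqrt (Gam \<rho> \<sigma> 0 lam lam c))))
      \<longlongrightarrow> st + (-1) ^ i / theta \<rho> \<sigma> * ln (sqrt ((eta \<rho> lam + 0) / (eta \<rho> lam - 0)) * 1)) (at_right 0)"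
    using eta_pos[OF rho lam] theta_pos[OF rho sigma]
    by (intro tendsto_add tendsto_mult tendsto_ln tendsto_const tendsto_real_sqrt tendsto_divide
        tendsto_diff xi_tendsto_0 sqrt_Gam_sum_tendsto) auto
  then show ?thesis
    using eta_pos[OF rho lam] by (simp add: xbar_def[abs_def] Let_def)
qed

lemma xstar_tendsto: "(xstar \<rho> \<sigma> 0 lam lam st i \<longlongrightarrow> st) (at_right 0)"
proof -
  have "((\<lambda>c. st + (-1) ^ i / theta \<rho> \<sigma>
      * ln (sqrt ((eta \<rho> lam - xi \<rho> \<sigma> lam c) / (eta \<rho> lam + xi \<rho> \<sigma> lam c))
        * (sqrt (Gam \<rho> \<sigma> 0 lam lam c + 1) + sqrt (Gam \<rho> \<sigma> 0 lam lam c))))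
      \<longlongrightarrow> st + (-1) ^ i / theta \<rho> \<sigma> * ln (sqrt ((eta \<rho> lam - 0) / (eta \<rho> lam + 0)) * 1)) (at_right 0)"
    using eta_pos[OF rho lam] theta_pos[OF rho sigma]
    by (intro tendsto_add tendsto_mult tendsto_ln tendsto_const tendsto_real_sqrt tendsto_divide
        tendsto_diff xi_tendsto_0 sqrt_Gam_sum_tendsto) auto
  then show ?thesis
    using eta_pos[OF rho lam] by (simp add: xstar_def[abs_def] Let_def)
qed

lemma A_tendsto:
  "(A \<rho> \<sigma> 0 lam lam st i j \<longlongrightarrow> exp ((-1) ^ j * theta \<rho> \<sigma> * st) * (eta \<rho> lam / (2 * theta \<rho> \<sigma>))
     * (-1) ^ (i + j + 1)) (at_right 0)"
proof -
  have "((\<lambda>c. exp ((-1) ^ j * theta \<rho> \<sigma> * st)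
      * (sqrt ((eta \<rho> lam)\<^sup>2 - (xi \<rho> \<sigma> lam c)\<^sup>2) / (2 * theta \<rho> \<sigma>))
      * ((-1) ^ (i + j + 1) * sqrt (Gam \<rho> \<sigma> 0 lam lam c + 1) - sqrt (Gam \<rho> \<sigma> 0 lam lam c)))
      \<longlongrightarrow> exp ((-1) ^ j * theta \<rho> \<sigma> * st) * (sqrt ((eta \<rho> lam)\<^sup>2 - 0\<^sup>2) / (2 * theta \<rho> \<sigma>))
      * ((-1) ^ (i + j + 1) * sqrt (0 + 1) - sqrt 0)) (at_right 0)"
    using theta_pos[OF rho sigma]
    by (intro tendsto_intros xi_tendsto_0 Gam_tendsto_0) auto
  then show ?thesis
    using eta_pos[OF rho lam] by (simp add: A_def[abs_def] Let_def)
qed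

text \<open>At \<open>st\<close> both exponential terms have modulus \<open>\<eta> / (2 \<theta>)\<close> in the limit, with opposite signs, and
  only the running payoff survives. The moving point \<open>y\<close> covers the targets as well as the
  constant state \<open>st\<close>.\<close>
lemma phi2_tendsto:
  assumes "(y \<longlongrightarrow> st) (at_right 0)"
  shows "((\<lambda>c. phi2 \<rho> \<sigma> s2 0 lam lam st c (y c)) \<longlongrightarrow> (s2 - st) / \<rho>) (at_right 0)"
proof -
  let ?h = "eta \<rho> lam / (2 * theta \<rho> \<sigma>)"
  have "((\<lambda>c. A \<rho> \<sigma> 0 lam lam st 2 1 c * exp (theta \<rho> \<sigma> * y c)
      + A \<rho> \<sigma> 0 lam lam st 2 2 c * exp (- theta \<rho> \<sigma> * y c) + (s2 - y c) / \<rho>)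
      \<longlongrightarrow> exp ((-1) ^ 1 * theta \<rho> \<sigma> * st) * ?h * (-1) ^ (2 + 1 + 1) * exp (theta \<rho> \<sigma> * st)
      + exp ((-1) ^ 2 * theta \<rho> \<sigma> * st) * ?h * (-1) ^ (2 + 2 + 1) * exp (- theta \<rho> \<sigma> * st)
      + (s2 - st) / \<rho>) (at_right 0)"
    using rho by (intro tendsto_intros A_tendsto assms) auto
  moreover have "exp ((-1) ^ 1 * theta \<rho> \<sigma> * st) * ?h * (-1) ^ (2 + 1 + 1) * exp (theta \<rho> \<sigma> * st)
      + exp ((-1) ^ 2 * theta \<rho> \<sigma> * st) * ?h * (-1) ^ (2 + 2 + 1) * exp (- theta \<rho> \<sigma> * st) = 0"
    by (simp add: exp_minus)
  ultimately show ?thesis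
    by (simp add: phi2_def[abs_def])
qed

text \<open>The continuation branch survives in the limit only at \<open>x = st\<close>. There the three branches
  have a common limit, which avoids locating \<open>st\<close> relative to the thresholds.\<close>
lemma V2_tendsto:
  "((\<lambda>c. V2 \<rho> \<sigma> s2 0 lam lam st c x) \<longlongrightarrow> (s2 - st) / \<rho> - lam * (x - st)) (at_right 0)"
proof -
  let ?L = "(s2 - st) / \<rho> - lam * (x - st)"
  let ?b = "xbar \<rho> \<sigma> 0 lam lam st" and ?s = "xstar \<rho> \<sigma> 0 lam lam st"
  let ?phi = "phi2 \<rho> \<sigma> s2 0 lam lam st"
  have V2: "V2 \<rho> \<sigma> s2 0 lam lam st c x =
      (if x \<le> ?b 1 c then ?phi c (?s 1 c) + 0 + lam * (?s 1 c - x)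
       else if x < ?b 2 c then ?phi c x else ?phi c (?s 2 c) - c - lam * (x - ?s 2 c))" for c
    by (simp add: V2_def Let_def)
  have "((\<lambda>c. ?phi c (?s 1 c) + 0 + lam * (?s 1 c - x))
      \<longlongrightarrow> (s2 - st) / \<rho> + 0 + lam * (st - x)) (at_right 0)"
    by (intro tendsto_add tendsto_mult tendsto_diff tendsto_const phi2_tendsto xstar_tendsto)
  moreover have "(s2 - st) / \<rho> + 0 + lam * (st - x) = ?L"
    by (simp add: right_diff_distrib)
  ultimately have left: "((\<lambda>c. ?phi c (?s 1 c) + 0 + lam * (?s 1 c - x)) \<longlongrightarrow> ?L) (at_right 0)"
    by simp
  have "((\<lambda>c. ?phi c (?s 2 c) - c - lam * (x - ?s 2 c))
      \<longlongrightarrow> (s2 - st) / \<rho> - 0 - lam * (x - st)) (at_right 0)"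
    by (intro tendsto_mult tendsto_diff tendsto_const tendsto_ident_at phi2_tendsto xstar_tendsto)
  then have right: "((\<lambda>c. ?phi c (?s 2 c) - c - lam * (x - ?s 2 c)) \<longlongrightarrow> ?L) (at_right 0)"
    by simp
  consider "x < st" | "x = st" | "x > st" by linarith
  then show ?thesis
  proof cases
    case 1
    have "\<forall>\<^sub>F c in at_right 0. x < ?b 1 c"
      using order_tendstoD(1)[OF xbar_tendsto 1] .
    then have "\<forall>\<^sub>F c in at_right 0. ?phi c (?s 1 c) + 0 + lam * (?s 1 c - x)
        = V2 \<rho> \<sigma> s2 0 lam lam st c x"
      by eventually_elim (simp add: V2)
    with left show ?thesis by (rule Lim_transform_eventually)
  next
    case 2
    have mid: "((\<lambda>c. ?phi c x) \<longlongrightarrow> ?L) (at_right 0)"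
      using phi2_tendsto[OF tendsto_const] 2 by simp
    show ?thesis
      unfolding V2
      by (intro filterlim_If tendsto_mono[OF _ left] tendsto_mono[OF _ mid] tendsto_mono[OF _ right])
        (auto intro: le_infI1)
  next
    case 3
    have "\<forall>\<^sub>F c in at_right 0. ?b 1 c < x" "\<forall>\<^sub>F c in at_right 0. ?b 2 c < x"
      using order_tendstoD(2)[OF xbar_tendsto 3] by auto
    then have "\<forall>\<^sub>F c in at_right 0. ?phi c (?s 2 c) - c - lam * (x - ?s 2 c)
        = V2 \<rho> \<sigma> s2 0 lam lam st c x"
      by eventually_elim (simp add: V2)
    with right show ?thesis by (rule Lim_transform_eventually)
  qed
qed

lemma V1_tendsto:
  "((\<lambda>c. V1 \<rho> \<sigma> s1 s2 0 lam lam st c x) \<longlongrightarrow> (st - s1) / \<rho> + lam * (x - st)) (at_right 0)"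
proof -
  have "((\<lambda>c. V1 \<rho> \<sigma> s1 s2 0 lam lam st c x)
      \<longlongrightarrow> (s2 - st) / \<rho> - lam * (2 * st - x - st) + (2 * st - (s1 + s2)) / \<rho>) (at_right 0)"
    unfolding V1_def by (intro tendsto_add V2_tendsto tendsto_const)
  also have "(s2 - st) / \<rho> - lam * (2 * st - x - st) + (2 * st - (s1 + s2)) / \<rho>
      = (st - s1) / \<rho> + lam * (x - st)"
    using rho by (simp add: field_simps)
  finally show ?thesis .
qed

end

theorem proposition4p10:
  fixes \<rho> \<sigma> s1 s2 ct lam lamt st :: real
  assumes "\<rho> > 0" and "\<sigma> > 0" and "s1 < s2"
    and "ct \<ge> 0" and "lam \<ge> lamt" and "lamt \<ge> 0" and "1 - lam * \<rho> > 0"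
    and "ct = 0" and "lam = lamt"
  shows "(\<forall>i\<in>{1, 2}.
            ((\<lambda>c. xbar \<rho> \<sigma> ct lam lamt st i c) \<longlongrightarrow> st) (at_right 0)
            \<and> ((\<lambda>c. xstar \<rho> \<sigma> ct lam lamt st i c) \<longlongrightarrow> st) (at_right 0))
       \<and> (\<forall>x. ((\<lambda>c. V1 \<rho> \<sigma> s1 s2 ct lam lamt st c x)
                 \<longlongrightarrow> (st - s1) / \<rho> + lam * (x - st)) (at_right 0)
            \<and> ((\<lambda>c. V2 \<rho> \<sigma> s2 ct lam lamt st c x)
                 \<longlongrightarrow> (s2 - st) / \<rho> - lam * (x - st)) (at_right 0))"
proof -
  note params = assms(1,2,7)
  have "ct = 0" "lamt = lam" using assms by simp_all
  then show ?thesis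
    using xbar_tendsto[OF params] xstar_tendsto[OF params] V1_tendsto[OF params] V2_tendsto[OF params]
    by simp
qed

end
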